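(* Let $(\mathbb{X},\oplus,\otimes,\mathbb{0},\mathbb{1})$ be a linearly ordered radicable idempotent semifield, let $n\geq 1$, $\mathbf{p},\mathbf{q},\mathbf{g}\in\mathbb{X}^{n}$ and $\mathbf{B}\in\mathbb{X}^{n\times n}$. Let $\mathbf{p}$ be a nonzero vector, $\mathbf{q}$ a regular vector, and $\mathbf{B}$ a matrix such that $\mathrm{Tr}(\mathbf{B})\leq\mathbb{1}$. Consider the problem of minimizing $\mathbf{q}^{-}\mathbf{x}\mathbf{x}^{-}\mathbf{p}$ over all regular vectors $\mathbf{x}\in\mathbb{X}^{n}$ subject to $\mathbf{B}\mathbf{x}\oplus\mathbf{g}\leq\mathbf{x}$. Then the minimum value in this problem is equal to $$\theta=\mathbf{q}^{-}\mathbf{B}^{\ast}\mathbf{p},$$ and all regular solutions of the problem are given by $$\mathbf{x}=(\theta^{-1}\mathbf{p}\mathbf{q}^{-}\oplus\mathbf{B})^{\ast}\mathbf{u},\qquad \mathbf{u}\geq\mathbf{g};$$ that is, a regular vector $\mathbf{x}$ is a solution of the problem if and only if it has this form for some $\mathbf{u}\in\mathbb{X}^{n}$ with $\mathbf{u}\geq\mathbf{g}$.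
   Context: Idempotent semifield: $\mathbb{X}$ is a set with two associative and commutative operations $\oplus$ (addition) and $\otimes$ (multiplication, sign usually omitted) with neutral elements $\mathbb{0}$ and $\mathbb{1}$ respectively; addition is idempotent ($x\oplus x=x$), multiplication distributes over addition, and each $x\neq\mathbb{0}$ has a multiplicative inverse $x^{-1}$ (and $\mathbb{0}$ is absorbing for multiplication). The order is defined by $x\leq y$ iff $x\oplus y=y$ and is assumed linear, so $x\oplus y=\max(x,y)$; "minimize" refers to this order. Radicable means that $x^{m}=a$ has a solution for every $a\neq\mathbb{0}$ and every integer $m\geq1$. Vectors and matrices: vectors in $\mathbb{X}^{n}$ are column vectors; matrix/vector operations follow the usual rules with $\oplus,\otimes$ in place of ordinary addition and multiplication; inequalities are componentwise. $\mathbf{I}$ is the identity matrix ($\mathbb{1}$ on the diagonal, $\mathbb{0}$ elsewhere), $\mathbf{A}^{0}=\mathbf{I}$, $\mathbf{A}^{m}=\mathbf{A}^{m-1}\mathbf{A}$. For $\mathbf{A}=(a_{ij})\in\mathbb{X}^{n\times n}$, $\mathrm{tr}\,\mathbf{A}=\bigoplus_{i=1}^{n}a_{ii}$ and $\mathrm{Tr}(\mathbf{A})=\bigoplus_{m=1}^{n}\mathrm{tr}\,\mathbf{A}^{m}$. If $\mathrm{Tr}(\mathbf{A})\leq\mathbb{1}$, the asterate (Kleene star) of $\mathbf{A}$ is $\mathbf{A}^{\ast}=\bigoplus_{m=0}^{n-1}\mathbf{A}^{m}$. A vector is nonzero if it has at least one entry $\neq\mathbb{0}$, and regular if none of its entries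 is $\mathbb{0}$. For a nonzero column vector $\mathbf{x}=(x_{i})$, the multiplicative conjugate transpose is the row vector $\mathbf{x}^{-}=(x_{i}^{-})$ with $x_{i}^{-}=x_{i}^{-1}$ if $x_{i}\neq\mathbb{0}$ and $x_{i}^{-}=\mathbb{0}$ otherwise. *)

theory Defs
  imports "HOL-Analysis.Determinants"
begin

text \<open>
  Idempotent addition, multiplication and their neutral elements are written
  \<open>+\<close>, \<open>*\<close>, \<open>0\<close>, \<open>1\<close>, so that library sums and matrix products are those over the semifield.
  The axiom \<open>0 \<noteq> 1\<close> inherited from \<^class>\<open>comm_semiring_1\<close> excludes only the one-element
  structure. The value of \<open>inverse 0\<close> is left unspecified.
\<close>

class linordered_idempotent_semifield = comm_semiring_1 + inverse + linorder +
  assumes add_idem: "x + x = x"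
    and left_inverse_nonzero: "x \<noteq> 0 \<Longrightarrow> inverse x * x = 1"
    and divide_eq_mult_inverse: "x / y = x * inverse y"
    and le_iff_add_eq: "x \<le> y \<longleftrightarrow> x + y = y"

class radicable_linordered_idempotent_semifield = linordered_idempotent_semifield +
  assumes radicable: "a \<noteq> 0 \<Longrightarrow> m \<ge> (1::nat) \<Longrightarrow> \<exists>x. x ^ m = a"

definition regular :: "'a::zero ^ 'n \<Rightarrow> bool" where
  "regular x \<longleftrightarrow> (\<forall>i. x $ i \<noteq> 0)"

text \<open>
  Row and column vectors share the type \<^typ>\<open>'a ^ 'n\<close>: \<open>row_times_col\<close> is the product of a row
  by a column (a scalar) and \<open>col_times_row\<close> the product of a column by a row (a matrix).
\<close>

definition conj_transpose :: "'a::linordered_idempotent_semifield ^ 'n \<Rightarrow> 'a ^ 'n" where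
  "conj_transpose x = (\<chi> i. if x $ i = 0 then 0 else inverse (x $ i))"

definition row_times_col :: "'a::semiring_1 ^ 'n \<Rightarrow> 'a ^ 'n \<Rightarrow> 'a" where
  "row_times_col r c = (\<Sum>i\<in>UNIV. r $ i * c $ i)"

definition col_times_row :: "'a::semiring_1 ^ 'n \<Rightarrow> 'a ^ 'n \<Rightarrow> 'a ^ 'n ^ 'n" where
  "col_times_row c r = (\<chi> i j. c $ i * r $ j)"

text \<open>The library's \<open>^\<close> on matrices is the entrywise power, hence a separate definition.\<close>

primrec mat_power :: "'a::semiring_1 ^ 'n ^ 'n \<Rightarrow> nat \<Rightarrow> 'a ^ 'n ^ 'n" where
  "mat_power A 0 = mat 1"
| "mat_power A (Suc m) = mat_power A m ** A"

definition Tr :: "'a::semiring_1 ^ 'n ^ 'n \<Rightarrow> 'a" where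
  "Tr A = (\<Sum>m=1..CARD('n). trace (mat_power A m))"

text \<open>
  The asterate exists only if \<open>Tr A \<le> 1\<close>; an equation involving it therefore has
  content only once this condition is known for its argument.
\<close>

definition asterate :: "'a::linordered_idempotent_semifield ^ 'n ^ 'n \<Rightarrow> 'a ^ 'n ^ 'n" where
  "asterate A = (if Tr A \<le> 1 then (\<Sum>m=0..CARD('n) - 1. mat_power A m) else undefined)"

definition objective ::
  "'a::linordered_idempotent_semifield ^ 'n \<Rightarrow> 'a ^ 'n \<Rightarrow> 'a ^ 'n \<Rightarrow> 'a" where
  "objective p q x =
     row_times_col (conj_transpose q) x * row_times_col (conj_transpose x) p"

definition feasible ::
  "'a::linordered_idempotent_semifield ^ 'n ^ 'n \<Rightarrow> 'a ^ 'n \<Rightarrow> 'a ^ 'n \<Rightarrow> bool" where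
  "feasible B g x \<longleftrightarrow> regular x \<and> B *v x + g \<le> x"

end

theory Submission
  imports Defs
begin

text \<open>
  Write \<open>\<theta> = q\<^sup>- B\<^sup>* p\<close> and \<open>C = \<theta>\<^sup>-\<^sup>1 p q\<^sup>- \<oplus> B\<close>. For regular \<open>x\<close>, every term of the objective
  \<open>q\<^sup>- x x\<^sup>- p\<close> has the form \<open>q\<^sub>j\<^sup>- x\<^sub>j x\<^sub>i\<^sup>-\<^sup>1 p\<^sub>i\<close>, so bounding the objective by \<open>\<theta>\<close> amounts to the linear
  inequality \<open>\<theta>\<^sup>-\<^sup>1 p q\<^sup>- x \<le> x\<close> (\<open>objective_le_iff\<close>). Feasibility together with an objective value of at
  most \<open>\<theta>\<close> is therefore the single system \<open>C x \<oplus> g \<le> x\<close>, and the theorem splits into three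
  questions about such systems.

  Why \<open>\<theta>\<close> is a lower bound: \<open>p \<le> (x\<^sup>- p) x\<close> for regular \<open>x\<close>, and if \<open>B x \<le> x\<close> then \<open>B\<^sup>*\<close> maps vectors
  below a multiple of \<open>x\<close> to vectors below the same multiple; multiplying by \<open>q\<^sup>-\<close> gives
  \<open>\<theta> \<le> (x\<^sup>- p) (q\<^sup>- x)\<close> (\<open>asterate_le_objective\<close>).

  Why \<open>\<theta>\<close> is attained: \<open>x = \<theta> (q\<^sup>- B\<^sup>*)\<^sup>-\<close>, the greatest vector with \<open>q\<^sup>- B\<^sup>* x \<le> \<theta>\<close>, is regular and
  satisfies \<open>C x \<le> x\<close> (\<open>regular_optimal_subsolution\<close>). A regular solution of \<open>C x \<le> x\<close> forces the
  diagonals of all powers of \<open>C\<close> below \<open>1\<close>, hence \<open>Tr C \<le> 1\<close>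
  (\<open>Tr_le_one_if_regular_subsolution\<close>). Then \<open>C\<^sup>* (x \<oplus> g)\<close> also dominates \<open>g\<close>.

  What the solutions are: when \<open>Tr A \<le> 1\<close>, the solutions of \<open>A x \<oplus> g \<le> x\<close> are exactly the vectors
  \<open>A\<^sup>* u\<close> with \<open>u \<ge> g\<close> (\<open>subsolution_iff_asterate\<close>). This rests on \<open>A A\<^sup>* \<le> A\<^sup>*\<close>, that is, on the
  \<open>n\<close>-th power being dominated by \<open>A\<^sup>*\<close>: by linearity of the order, an entry of \<open>A\<^sup>n\<close> is the weight
  of one walk of length \<open>n\<close>, which visits some vertex twice, and cutting out the
  cycle, of weight at most \<open>1\<close>, does not decrease the weight (\<open>mat_power_card_le_shorter\<close>).
\<close>

section \<open>Order and sums in an idempotent semifield\<close>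

text \<open>
  The order given by idempotent addition is the one in which sums are suprema, so it is
  compatible with both operations and has \<open>0\<close> as least element. Registering this makes the
  library's monotonicity rules applicable.
\<close>

instance linordered_idempotent_semifield \<subseteq> canonically_ordered_monoid_add
proof
  fix a b :: 'a
  show "a \<le> b \<longleftrightarrow> (\<exists>c. b = a + c)"
    by (metis add.assoc add_idem le_iff_add_eq)
qed

instance linordered_idempotent_semifield \<subseteq> ordered_comm_semiring
proof
  fix a b c :: 'a
  show "a \<le> b \<Longrightarrow> c * a \<le> c * b"
    by (metis distrib_left le_iff_add_eq)
qed

lemma add_le_iff:
  fixes x y z :: "'a::linordered_idempotent_semifield"
  shows "x + y \<le> z \<longleftrightarrow> x \<le> z \<and> y \<le> z"
  by (metis add.assoc add.commute le_iff_add le_iff_add_eq)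

lemma sum_le_iff:
  fixes f :: "'b \<Rightarrow> 'a::linordered_idempotent_semifield"
  assumes "finite S"
  shows "sum f S \<le> c \<longleftrightarrow> (\<forall>i\<in>S. f i \<le> c)"
  using assms by (induction S) (auto simp: add_le_iff)

lemma le_sum:
  fixes f :: "'b \<Rightarrow> 'a::linordered_idempotent_semifield"
  assumes "finite S" "i \<in> S"
  shows "f i \<le> sum f S"
  using assms sum_le_iff by blast

text \<open>
  Finite sums are maxima of a linear order, so one summand realizes the sum. This is what
  turns an entry of a matrix power into the weight of a single walk.
\<close>

lemma sum_attained:
  fixes f :: "'b \<Rightarrow> 'a::linordered_idempotent_semifield"
  assumes "finite S" "S \<noteq> {}"
  shows "\<exists>i\<in>S. sum f S = f i"
  using assms
proof (induction S rule: finite_ne_induct)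
  case (insert x F)
  then show ?case
    by (metis add.commute insert_iff le_iff_add_eq linear sum.insert)
qed simp

lemma mult_le_iff_le_inverse_mult:
  fixes c x y :: "'a::linordered_idempotent_semifield"
  assumes "c \<noteq> 0"
  shows "c * x \<le> y \<longleftrightarrow> x \<le> inverse c * y"
proof
  have inv: "inverse c * (c * z) = z" "c * (inverse c * z) = z" for z
    using left_inverse_nonzero[OF assms] by (metis mult.assoc mult.commute mult_1)+
  show "c * x \<le> y \<Longrightarrow> x \<le> inverse c * y"
    using mult_left_mono[of "c * x" y "inverse c"] inv by simp
  show "x \<le> inverse c * y \<Longrightarrow> c * x \<le> y"
    using mult_left_mono[of x "inverse c * y" c] inv by simp
qed

lemma inverse_neq_zero:
  fixes c :: "'a::linordered_idempotent_semifield"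
  assumes "c \<noteq> 0"
  shows "inverse c \<noteq> 0"
  using left_inverse_nonzero[OF assms] by auto

lemma inverse_mult_le_iff:
  fixes c x y :: "'a::linordered_idempotent_semifield"
  assumes "c \<noteq> 0"
  shows "inverse c * x \<le> y \<longleftrightarrow> x \<le> c * y"
proof -
  have "inverse (inverse c) = c"
    using left_inverse_nonzero[OF assms]
      left_inverse_nonzero[OF inverse_neq_zero[OF assms]]
    by (metis mult.assoc mult.commute mult_1)
  then show ?thesis
    using mult_le_iff_le_inverse_mult[OF inverse_neq_zero[OF assms], of x y] by simp
qed

lemma mult_neq_zero:
  fixes a b :: "'a::linordered_idempotent_semifield"
  assumes "a \<noteq> 0" "b \<noteq> 0"
  shows "a * b \<noteq> 0"
  by (metis assms left_inverse_nonzero mult.assoc mult_1 mult_zero_right)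

section \<open>Vectors and subsolutions\<close>

lemma regular_mono:
  fixes x y :: "'a::linordered_idempotent_semifield ^ 'n"
  assumes "regular x" "x \<le> y"
  shows "regular y"
  using assms unfolding regular_def less_eq_vec_def by (metis le_zero_eq)

lemma matrix_vector_mult_le_iff:
  fixes A :: "'a::linordered_idempotent_semifield ^ 'm ^ 'n"
  shows "A *v x \<le> y \<longleftrightarrow> (\<forall>i j. A $ i $ j * x $ j \<le> y $ i)"
  by (simp add: less_eq_vec_def matrix_vector_mult_def sum_le_iff)

lemma matrix_vector_mult_mono:
  fixes A :: "'a::linordered_idempotent_semifield ^ 'm ^ 'n"
  assumes "x \<le> y"
  shows "A *v x \<le> A *v y"
  using assms by (simp add: less_eq_vec_def matrix_vector_mult_def sum_mono mult_left_mono)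

lemma mat_power_add:
  "mat_power A (m + k) = mat_power A m ** mat_power A k"
  by (induction k) (simp_all add: matrix_mul_assoc)

lemma mat_power_vector_le:
  fixes A :: "'a::linordered_idempotent_semifield ^ 'n ^ 'n"
  assumes "A *v x \<le> x"
  shows "mat_power A m *v x \<le> x"
proof (induction m)
  case (Suc m)
  have "mat_power A (Suc m) *v x = mat_power A m *v (A *v x)"
    by (simp add: matrix_vector_mul_assoc)
  also have "\<dots> \<le> mat_power A m *v x"
    by (rule matrix_vector_mult_mono[OF assms])
  also have "\<dots> \<le> x" by (rule Suc.IH)
  finally show ?case .
qed (simp add: matrix_vector_mul_lid)

text \<open>
  From \<open>A\<^sup>m x \<le> x\<close> follows \<open>(A\<^sup>m)\<^sub>i\<^sub>i x\<^sub>i \<le> x\<^sub>i\<close>, and \<open>x\<^sub>i\<close> can be cancelled because it is nonzero.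
\<close>

lemma Tr_le_one_if_regular_subsolution:
  fixes A :: "'a::linordered_idempotent_semifield ^ 'n ^ 'n"
  assumes "regular x" "A *v x \<le> x"
  shows "Tr A \<le> 1"
proof -
  have "mat_power A m $ i $ i \<le> 1" for m i
  proof -
    have x: "x $ i \<noteq> 0" using assms(1) by (simp add: regular_def)
    have "x $ i * mat_power A m $ i $ i \<le> x $ i"
      using mat_power_vector_le[OF assms(2), of m]
      by (simp add: matrix_vector_mult_le_iff mult.commute)
    then show ?thesis
      using mult_le_iff_le_inverse_mult[OF x] left_inverse_nonzero[OF x] by simp
  qed
  then show ?thesis by (simp add: Tr_def trace_def sum_le_iff)
qed

section \<open>Walks and matrix powers\<close>

lemma mat_power_entry_le_one:
  fixes A :: "'a::linordered_idempotent_semifield ^ 'n ^ 'n"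
  assumes "Tr A \<le> 1" "1 \<le> m" "m \<le> CARD('n)"
  shows "mat_power A m $ i $ i \<le> 1"
  using assms by (auto simp: Tr_def trace_def sum_le_iff)

lemma matrix_mult_entry_ge:
  fixes A :: "'a::linordered_idempotent_semifield ^ 'm ^ 'n"
  shows "A $ i $ k * B $ k $ j \<le> (A ** B) $ i $ j"
  by (simp add: matrix_matrix_mult_def le_sum[where f = "\<lambda>k. A $ i $ k * B $ k $ j"])

text \<open>
  A walk is a sequence \<open>k\<close> of vertices, its weight over the times \<open>a\<close> to \<open>b\<close> being the product of
  the entries it traverses; an entry of a matrix power is the supremum of the weights of the
  walks of that length. This is the upper-bound half; the times are kept general
  so that it applies to segments of a walk.
\<close>

lemma walk_weight_le_mat_power:
  fixes A :: "'a::linordered_idempotent_semifield ^ 'n ^ 'n"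
  assumes "a \<le> b"
  shows "(\<Prod>t=a..<b. A $ k t $ k (Suc t)) \<le> mat_power A (b - a) $ k a $ k b"
  using assms
proof (induction b rule: dec_induct)
  case (step b)
  have "(\<Prod>t=a..<Suc b. A $ k t $ k (Suc t))
      \<le> mat_power A (b - a) $ k a $ k b * A $ k b $ k (Suc b)"
    using step by (simp add: mult_right_mono)
  also have "\<dots> \<le> mat_power A (Suc b - a) $ k a $ k (Suc b)"
    using step matrix_mult_entry_ge[of "mat_power A (b - a)"] by (simp add: Suc_diff_le)
  finally show ?case .
qed (simp add: mat_def)

text \<open>
  The supremum over walks is attained. The entry has to be nonzero: for \<open>m = 0\<close> and \<open>i \<noteq> j\<close>
  there is no walk at all.
\<close>

lemma mat_power_entry_is_walk_weight:
  fixes A :: "'a::linordered_idempotent_semifield ^ 'n ^ 'n"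
  assumes "mat_power A m $ i $ j \<noteq> 0"
  shows "\<exists>k. k 0 = i \<and> k m = j \<and> mat_power A m $ i $ j = (\<Prod>t=0..<m. A $ k t $ k (Suc t))"
  using assms
proof (induction m arbitrary: j)
  case 0
  then show ?case by (intro exI[of _ "\<lambda>_. i"]) (auto simp: mat_def split: if_splits)
next
  case (Suc m)
  obtain l where l: "mat_power A (Suc m) $ i $ j = mat_power A m $ i $ l * A $ l $ j"
    using sum_attained[of UNIV "\<lambda>l. mat_power A m $ i $ l * A $ l $ j"]
    by (auto simp: matrix_matrix_mult_def)
  with Suc.prems have "mat_power A m $ i $ l \<noteq> 0" by auto
  with Suc.IH obtain k where k: "k 0 = i" "k m = l"
    "mat_power A m $ i $ l = (\<Prod>t=0..<m. A $ k t $ k (Suc t))" by blast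
  define k' where "k' = k(Suc m := j)"
  have "(\<Prod>t=0..<m. A $ k' t $ k' (Suc t)) = (\<Prod>t=0..<m. A $ k t $ k (Suc t))"
    by (rule prod.cong) (auto simp: k'_def)
  then show ?case using k l by (intro exI[of _ k']) (auto simp: k'_def)
qed

text \<open>
  A walk with \<open>n\<close> steps visits \<open>n + 1\<close> vertices among \<open>n\<close>, so it contains a cycle of length at
  most \<open>n\<close>. The hypothesis bounds the weight of that cycle by \<open>1\<close>; removing it leaves a shorter
  walk between the same ends and of at least the same weight.
\<close>

lemma mat_power_card_le_shorter:
  fixes A :: "'a::linordered_idempotent_semifield ^ 'n ^ 'n"
  assumes "Tr A \<le> 1"
  shows "\<exists>m<CARD('n). mat_power A CARD('n) $ i $ j \<le> mat_power A m $ i $ j"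
proof (cases "mat_power A CARD('n) $ i $ j = 0")
  case True
  then show ?thesis by (intro exI[of _ 0]) simp
next
  case False
  define n where "n = CARD('n)"
  define w where "w a b k = (\<Prod>t=a..<b. A $ k t $ k (Suc t))" for a b and k :: "nat \<Rightarrow> 'n"
  obtain k where k: "k 0 = i" "k n = j" "mat_power A n $ i $ j = w 0 n k"
    using mat_power_entry_is_walk_weight[OF False] unfolding w_def n_def by blast
  have "\<not> inj_on k {0..n}"
    using card_inj_on_le[of k "{0..n}" UNIV] by (auto simp: n_def)
  then obtain a b where ab: "a < b" "b \<le> n" "k a = k b"
    unfolding inj_on_def by (metis atLeastAtMost_iff linorder_neqE_nat)
  have cycle: "w a b k \<le> 1"
  proof -
    have "w a b k \<le> mat_power A (b - a) $ k a $ k a"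
      using walk_weight_le_mat_power[of a b A k] ab by (simp add: w_def)
    also have "\<dots> \<le> 1"
      using ab by (intro mat_power_entry_le_one[OF assms]) (auto simp: n_def)
    finally show ?thesis .
  qed
  \<comment> \<open>The cycle sits between the times \<open>a\<close> and \<open>b\<close>; what remains has \<open>a + (n - b) < n\<close> steps.\<close>
  have "w 0 n k = w 0 a k * w b n k * w a b k"
    using prod.atLeastLessThan_concat[of 0 a b "\<lambda>t. A $ k t $ k (Suc t)"]
      prod.atLeastLessThan_concat[of 0 b n "\<lambda>t. A $ k t $ k (Suc t)"] ab
    by (simp add: w_def ac_simps flip: mult.assoc)
  also have "\<dots> \<le> w 0 a k * w b n k"
    using mult_left_mono[OF cycle, of "w 0 a k * w b n k"] by simp
  also have "\<dots> \<le> mat_power A a $ i $ k a * mat_power A (n - b) $ k a $ j"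
    using walk_weight_le_mat_power[of 0 a A k] walk_weight_le_mat_power[of b n A k] ab k
    by (simp add: w_def mult_mono)
  also have "\<dots> \<le> mat_power A (a + (n - b)) $ i $ j"
    by (simp add: mat_power_add matrix_mult_entry_ge)
  finally have "mat_power A n $ i $ j \<le> mat_power A (a + (n - b)) $ i $ j"
    using k by simp
  moreover have "a + (n - b) < n" using ab by simp
  ultimately show ?thesis unfolding n_def by blast
qed

section \<open>The asterate solves linear inequalities\<close>

lemma asterate_le_iff:
  fixes A :: "'a::linordered_idempotent_semifield ^ 'n ^ 'n"
  assumes "Tr A \<le> 1"
  shows "asterate A \<le> M \<longleftrightarrow> (\<forall>m<CARD('n). mat_power A m \<le> M)"
proof -
  have "m \<le> CARD('n) - 1 \<longleftrightarrow> m < CARD('n)" for m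
    using zero_less_card_finite[where 'a = 'n] by linarith
  then show ?thesis
    using assms by (auto simp: asterate_def less_eq_vec_def sum_le_iff)
qed

text \<open>
  The asterate is a sum of the powers below \<open>n\<close>; the point of this lemma is that the power \<open>n\<close>
  is dominated as well.
\<close>

lemma mat_power_le_asterate:
  fixes A :: "'a::linordered_idempotent_semifield ^ 'n ^ 'n"
  assumes "Tr A \<le> 1" "m \<le> CARD('n)"
  shows "mat_power A m \<le> asterate A"
proof (cases "m < CARD('n)")
  case True
  then show ?thesis using asterate_le_iff[OF assms(1)] by blast
next
  case False
  then have m: "m = CARD('n)" using assms(2) by simp
  show ?thesis
    unfolding less_eq_vec_def m
    using mat_power_card_le_shorter[OF assms(1)] asterate_le_iff[OF assms(1), of "asterate A"]
    by (meson less_eq_vec_def order_refl order_trans)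
qed

lemma mat_one_le_asterate:
  fixes A :: "'a::linordered_idempotent_semifield ^ 'n ^ 'n"
  assumes "Tr A \<le> 1"
  shows "mat 1 \<le> asterate A"
  using mat_power_le_asterate[OF assms, of 0] by simp

lemma asterate_entry:
  fixes A :: "'a::linordered_idempotent_semifield ^ 'n ^ 'n"
  assumes "Tr A \<le> 1"
  shows "\<exists>m<CARD('n). asterate A $ i $ j = mat_power A m $ i $ j"
proof -
  obtain m where "m \<le> CARD('n) - 1" "asterate A $ i $ j = mat_power A m $ i $ j"
    using assms sum_attained[of "{0..CARD('n) - 1}" "\<lambda>m. mat_power A m $ i $ j"]
    by (auto simp: asterate_def)
  moreover have "CARD('n) - 1 < CARD('n)" by simp
  ultimately show ?thesis using order_le_less_trans by blast
qed

text \<open>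
  Multiplying \<open>A\<^sup>*\<close> by \<open>A\<close> on either side shifts each power by one, and the only power that leaves
  the defining range, \<open>A\<^sup>n\<close>, is still below \<open>A\<^sup>*\<close>. The left-hand version serves column vectors
  \<open>A\<^sup>* u\<close>, the right-hand version the row vector \<open>q\<^sup>- B\<^sup>*\<close>.
\<close>

lemma asterate_absorbs:
  fixes A :: "'a::linordered_idempotent_semifield ^ 'n ^ 'n"
  assumes "Tr A \<le> 1"
  shows "A $ i $ k * asterate A $ k $ j \<le> asterate A $ i $ j"
    and "asterate A $ i $ k * A $ k $ j \<le> asterate A $ i $ j"
proof -
  have le: "mat_power A (Suc m) $ i $ j \<le> asterate A $ i $ j" if "m < CARD('n)" for m
    using mat_power_le_asterate[OF assms, of "Suc m"] that by (simp add: less_eq_vec_def)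
  obtain m where m: "m < CARD('n)" "asterate A $ k $ j = mat_power A m $ k $ j"
    using asterate_entry[OF assms] by blast
  have "A ** mat_power A m = mat_power A (Suc m)"
    using mat_power_add[of A 1 m] by simp
  then show "A $ i $ k * asterate A $ k $ j \<le> asterate A $ i $ j"
    using order_trans[OF matrix_mult_entry_ge[of A i k "mat_power A m" j]] le[OF m(1)] m(2) by simp
  obtain m where m: "m < CARD('n)" "asterate A $ i $ k = mat_power A m $ i $ k"
    using asterate_entry[OF assms] by blast
  then show "asterate A $ i $ k * A $ k $ j \<le> asterate A $ i $ j"
    using order_trans[OF matrix_mult_entry_ge[of "mat_power A m" i k A j]] le[OF m(1)] by simp
qed

lemma le_asterate_vector:
  fixes A :: "'a::linordered_idempotent_semifield ^ 'n ^ 'n"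
  assumes "Tr A \<le> 1"
  shows "u \<le> asterate A *v u"
proof -
  have "u $ i \<le> (asterate A *v u) $ i" for i
  proof -
    have "1 \<le> asterate A $ i $ i"
      using mat_one_le_asterate[OF assms] by (simp add: less_eq_vec_def mat_def) metis
    then have "u $ i \<le> asterate A $ i $ i * u $ i"
      using mult_right_mono[of 1 "asterate A $ i $ i" "u $ i"] by simp
    also have "\<dots> \<le> (asterate A *v u) $ i"
      using matrix_vector_mult_le_iff[of "asterate A" u "asterate A *v u"] by simp
    finally show ?thesis .
  qed
  then show ?thesis by (simp add: less_eq_vec_def)
qed

lemma asterate_vector_subsolution:
  fixes A :: "'a::linordered_idempotent_semifield ^ 'n ^ 'n"
  assumes "Tr A \<le> 1"
  shows "A *v (asterate A *v u) \<le> asterate A *v u"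
proof -
  have "(A ** asterate A) $ i $ j \<le> asterate A $ i $ j" for i j
    using asterate_absorbs(1)[OF assms] by (simp add: matrix_matrix_mult_def sum_le_iff)
  then have "(A ** asterate A) *v u \<le> asterate A *v u"
    by (auto simp: less_eq_vec_def matrix_vector_mult_def intro!: sum_mono mult_right_mono)
  then show ?thesis by (simp add: matrix_vector_mul_assoc)
qed

text \<open>
  With \<open>le_asterate_vector\<close> and \<open>asterate_vector_subsolution\<close> this characterizes \<open>A\<^sup>* u\<close> as the least
  solution of \<open>A x \<oplus> u \<le> x\<close>.
\<close>

lemma asterate_vector_least:
  fixes A :: "'a::linordered_idempotent_semifield ^ 'n ^ 'n"
  assumes "Tr A \<le> 1" "A *v x \<le> x" "u \<le> x"
  shows "asterate A *v u \<le> x"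
proof -
  have "asterate A $ i $ j * u $ j \<le> x $ i" for i j
  proof -
    obtain m where "asterate A $ i $ j = mat_power A m $ i $ j"
      using asterate_entry[OF assms(1), of i j] by auto
    moreover have "mat_power A m *v u \<le> x"
      by (rule order_trans[OF matrix_vector_mult_mono[OF assms(3)] mat_power_vector_le[OF assms(2)]])
    ultimately show ?thesis by (metis matrix_vector_mult_le_iff)
  qed
  then show ?thesis by (simp add: matrix_vector_mult_le_iff)
qed

text \<open>
  A solution \<open>x\<close> is its own parameter: \<open>x = A\<^sup>* x\<close>, because \<open>x\<close> is the least subsolution above \<open>x\<close>.
\<close>

lemma subsolution_iff_asterate:
  fixes A :: "'a::linordered_idempotent_semifield ^ 'n ^ 'n"
  assumes "Tr A \<le> 1"
  shows "A *v x \<le> x \<and> g \<le> x \<longleftrightarrow> (\<exists>u. g \<le> u \<and> x = asterate A *v u)"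
proof
  assume "A *v x \<le> x \<and> g \<le> x"
  then have "x = asterate A *v x"
    using asterate_vector_least[OF assms, of x x] le_asterate_vector[OF assms, of x]
    by (simp add: order_antisym)
  then show "\<exists>u. g \<le> u \<and> x = asterate A *v u"
    using \<open>A *v x \<le> x \<and> g \<le> x\<close> by blast
next
  assume "\<exists>u. g \<le> u \<and> x = asterate A *v u"
  then obtain u where u: "g \<le> u" "x = asterate A *v u" by blast
  show "A *v x \<le> x \<and> g \<le> x"
    unfolding u(2)
    by (intro conjI asterate_vector_subsolution[OF assms]
        order_trans[OF u(1) le_asterate_vector[OF assms]])
qed

section \<open>The optimization problem\<close>

lemma row_times_col_le_iff:
  fixes r :: "'a::linordered_idempotent_semifield ^ 'n"
  shows "row_times_col r c \<le> y \<longleftrightarrow> (\<forall>i. r $ i * c $ i \<le> y)"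
  by (simp add: row_times_col_def sum_le_iff)

text \<open>
  Both sides are families of scalar inequalities indexed by \<open>i\<close> and \<open>j\<close>; the member for
  \<open>(i, j)\<close> is carried from one side to the other by moving the invertible scalars \<open>\<theta>\<close> and \<open>x\<^sub>i\<close>.
\<close>

lemma objective_le_iff:
  fixes p q x :: "'a::linordered_idempotent_semifield ^ 'n"
  assumes "regular x" "\<theta> \<noteq> 0"
  shows "objective p q x \<le> \<theta> \<longleftrightarrow>
    col_times_row (inverse \<theta> *s p) (conj_transpose q) *v x \<le> x"
proof -
  have "conj_transpose q $ j * x $ j * (conj_transpose x $ i * p $ i) \<le> \<theta> \<longleftrightarrow>
      inverse \<theta> * p $ i * conj_transpose q $ j * x $ j \<le> x $ i" for i j
  proof -
    have x: "x $ i \<noteq> 0" using assms(1) by (simp add: regular_def)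
    let ?t = "conj_transpose q $ j * x $ j * p $ i"
    have "conj_transpose q $ j * x $ j * (conj_transpose x $ i * p $ i) = inverse (x $ i) * ?t"
      using x by (simp add: conj_transpose_def ac_simps)
    moreover have "inverse (x $ i) * ?t \<le> \<theta> \<longleftrightarrow> inverse \<theta> * ?t \<le> x $ i"
      using inverse_mult_le_iff[OF x] inverse_mult_le_iff[OF assms(2)] by (metis mult.commute)
    moreover have "inverse \<theta> * ?t = inverse \<theta> * p $ i * conj_transpose q $ j * x $ j"
      by (simp add: ac_simps)
    ultimately show ?thesis by simp
  qed
  then show ?thesis
    by (auto simp: objective_def row_times_col_def sum_product sum_le_iff
        matrix_vector_mult_le_iff col_times_row_def)
qed

text \<open>
  The scalar \<open>s = x\<^sup>- p\<close> is the least one with \<open>p \<le> s x\<close>. As \<open>s x\<close> is a subsolution of \<open>B\<close> along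
  with \<open>x\<close>, it also dominates \<open>B\<^sup>* p\<close>, and \<open>q\<^sup>- (s x)\<close> is the objective.
\<close>

lemma asterate_le_objective:
  fixes p q x :: "'a::linordered_idempotent_semifield ^ 'n"
  assumes "Tr B \<le> 1" "regular x" "B *v x \<le> x"
  shows "row_times_col (conj_transpose q) (asterate B *v p) \<le> objective p q x"
proof -
  define s where "s = row_times_col (conj_transpose x) p"
  have "p $ i \<le> s * x $ i" for i
  proof -
    have x: "x $ i \<noteq> 0" using assms(2) by (simp add: regular_def)
    then have "inverse (x $ i) * p $ i \<le> s"
      unfolding s_def row_times_col_def
      using le_sum[of UNIV i "\<lambda>i. conj_transpose x $ i * p $ i"]
      by (simp add: conj_transpose_def)
    then show ?thesis using inverse_mult_le_iff[OF x] by (simp add: mult.commute)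
  qed
  then have p: "p \<le> s *s x" by (simp add: less_eq_vec_def)
  have "B $ i $ j * (s * x $ j) \<le> s * x $ i" for i j
    using assms(3) mult_left_mono[of "B $ i $ j * x $ j" "x $ i" s]
    by (simp add: matrix_vector_mult_le_iff mult.left_commute)
  then have "B *v (s *s x) \<le> s *s x" by (simp add: matrix_vector_mult_le_iff)
  then have "asterate B *v p \<le> s *s x"
    using asterate_vector_least[OF assms(1)] p by blast
  then have "row_times_col (conj_transpose q) (asterate B *v p)
      \<le> row_times_col (conj_transpose q) (s *s x)"
    by (auto simp: row_times_col_def less_eq_vec_def intro!: sum_mono mult_left_mono)
  also have "\<dots> = objective p q x"
    unfolding objective_def s_def[symmetric]
    by (simp add: row_times_col_def sum_distrib_left ac_simps)
  finally show ?thesis .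
qed

text \<open>
  The witness comes from residuation. Any \<open>x\<close> with \<open>B x \<le> x\<close> satisfies \<open>B\<^sup>* x = x\<close>, so \<open>q\<^sup>- x \<le> \<theta>\<close>
  amounts to \<open>z x \<le> \<theta>\<close> for the row \<open>z = q\<^sup>- B\<^sup>*\<close>, and the greatest solution of the latter has the
  components \<open>z\<^sub>i\<^sup>-\<^sup>1 \<theta>\<close>. It dominates \<open>p\<close>, since \<open>z p = \<theta>\<close>, so that \<open>x\<^sup>- p \<le> 1\<close>; and
  \<open>B x \<le> x\<close> is the dual form of \<open>z B \<le> z\<close>.
\<close>

lemma regular_optimal_subsolution:
  fixes p q :: "'a::linordered_idempotent_semifield ^ 'n"
  assumes "regular q" "Tr B \<le> 1"
    and \<theta>: "\<theta> = row_times_col (conj_transpose q) (asterate B *v p)" "\<theta> \<noteq> 0"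
  shows "\<exists>x. regular x \<and> B *v x \<le> x \<and> objective p q x \<le> \<theta>"
proof -
  define z where "z j = (\<Sum>i\<in>UNIV. conj_transpose q $ i * asterate B $ i $ j)" for j
  define x :: "'a ^ 'n" where "x = (\<chi> i. inverse (z i) * \<theta>)"
  have q: "conj_transpose q $ i \<noteq> 0" for i
    using assms(1) by (simp add: conj_transpose_def regular_def inverse_neq_zero)
  have qz: "conj_transpose q $ j \<le> z j" for j
  proof -
    have "1 \<le> asterate B $ j $ j"
      using mat_one_le_asterate[OF assms(2)] by (simp add: less_eq_vec_def mat_def) metis
    then have "conj_transpose q $ j \<le> conj_transpose q $ j * asterate B $ j $ j"
      using mult_left_mono[of 1 "asterate B $ j $ j" "conj_transpose q $ j"] by simp
    also have "\<dots> \<le> z j"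
      by (simp add: z_def le_sum[where f = "\<lambda>i. conj_transpose q $ i * asterate B $ i $ j"])
    finally show ?thesis .
  qed
  have z: "z j \<noteq> 0" for j using qz[of j] q[of j] by auto
  have zx: "z i * x $ i = \<theta>" for i
    using left_inverse_nonzero[OF z[of i]] by (simp add: x_def mult.commute mult.left_commute)
  have zB: "z i * B $ i $ j \<le> z j" for i j
    unfolding z_def sum_distrib_right
    using asterate_absorbs(2)[OF assms(2)]
    by (intro sum_mono) (simp add: mult.assoc mult_left_mono)
  have reg: "regular x"
    using \<theta>(2) zx by (metis mult_zero_right regular_def)
  have "B $ i $ j * x $ j \<le> x $ i" for i j
  proof -
    have "z i * (B $ i $ j * x $ j) \<le> \<theta>"
      using mult_right_mono[OF zB[of i j], of "x $ j"] zx by (simp add: mult.assoc)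
    then show ?thesis using mult_le_iff_le_inverse_mult[OF z] by (simp add: x_def)
  qed
  then have sub: "B *v x \<le> x" by (simp add: matrix_vector_mult_le_iff)
  have "p $ i \<le> x $ i" for i
  proof -
    have "\<theta> = (\<Sum>j\<in>UNIV. z j * p $ j)"
      unfolding \<theta>(1) row_times_col_def z_def
      by (simp add: matrix_vector_mult_def sum_distrib_left sum_distrib_right mult.assoc)
         (rule sum.swap)
    then have "z i * p $ i \<le> \<theta>"
      by (simp add: le_sum[where f = "\<lambda>j. z j * p $ j"])
    then show ?thesis using mult_le_iff_le_inverse_mult[OF z] by (simp add: x_def)
  qed
  then have px: "conj_transpose x $ i * p $ i \<le> 1" for i
    using reg inverse_mult_le_iff[of "x $ i" "p $ i" 1]
    by (simp add: conj_transpose_def regular_def)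
  have "conj_transpose q $ j * x $ j \<le> \<theta>" for j
    using mult_right_mono[OF qz[of j], of "x $ j"] zx by simp
  then have "objective p q x \<le> \<theta> * 1"
    unfolding objective_def using px
    by (intro mult_mono) (simp_all add: row_times_col_le_iff)
  then show ?thesis using reg sub by auto
qed

theorem theorem9:
  fixes p q g :: "'a::radicable_linordered_idempotent_semifield ^ 'n"
    and B :: "'a ^ 'n ^ 'n"
    and \<theta> :: 'a
  assumes "p \<noteq> 0"
    and "regular q"
    and "Tr B \<le> 1"
    and "\<theta> = row_times_col (conj_transpose q) (asterate B *v p)"
  shows "(\<exists>x. is_arg_min (objective p q) (feasible B g) x \<and> objective p q x = \<theta>) \<and>
    (\<forall>x. regular x \<longrightarrow>
       (is_arg_min (objective p q) (feasible B g) x \<longleftrightarrow>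
        (\<exists>u. g \<le> u \<and>
             x = asterate (col_times_row (inverse \<theta> *s p) (conj_transpose q) + B) *v u)))"
proof -
  define C where "C = col_times_row (inverse \<theta> *s p) (conj_transpose q) + B"
  have \<theta>: "\<theta> \<noteq> 0"
  proof -
    obtain i where i: "p $ i \<noteq> 0" using assms(1) by (auto simp: vec_eq_iff)
    then have "(asterate B *v p) $ i \<noteq> 0"
      using le_asterate_vector[OF assms(3), of p] by (metis le_zero_eq less_eq_vec_def)
    then have "conj_transpose q $ i * (asterate B *v p) $ i \<noteq> 0"
      using assms(2)
      by (intro mult_neq_zero) (auto simp: conj_transpose_def regular_def inverse_neq_zero)
    then show ?thesis
      using assms(4) row_times_col_le_iff[of "conj_transpose q" "asterate B *v p" 0] by auto
  qed
  have C_iff: "C *v x \<le> x \<longleftrightarrow> objective p q x \<le> \<theta> \<and> B *v x \<le> x" if "regular x" for x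
    unfolding objective_le_iff[OF that \<theta>] C_def
    by (auto simp: matrix_vector_mult_le_iff distrib_right add_le_iff)
  have feasible_iff: "feasible B g x \<longleftrightarrow> regular x \<and> B *v x \<le> x \<and> g \<le> x" for x
    by (auto simp: feasible_def less_eq_vec_def add_le_iff)
  have lower: "\<theta> \<le> objective p q x" if "feasible B g x" for x
    using that asterate_le_objective[OF assms(3)] by (simp add: feasible_iff assms(4))
  obtain x where x: "regular x" "C *v x \<le> x"
    using regular_optimal_subsolution[OF assms(2,3,4) \<theta>] C_iff by blast
  have Tr_C: "Tr C \<le> 1" by (rule Tr_le_one_if_regular_subsolution[OF x])
  obtain y where y: "feasible B g y" "objective p q y = \<theta>"
  proof
    \<comment> \<open>Adding \<open>x\<close> to the parameter keeps the vector regular even if \<open>g\<close> is not.\<close>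
    let ?y = "asterate C *v (x + g)"
    have "x \<le> ?y" "g \<le> ?y"
      using le_asterate_vector[OF Tr_C, of "x + g"] by (auto simp: less_eq_vec_def add_le_iff)
    moreover have "C *v ?y \<le> ?y" by (rule asterate_vector_subsolution[OF Tr_C])
    ultimately have "feasible B g ?y" "objective p q ?y \<le> \<theta>"
      using regular_mono[OF x(1)] C_iff feasible_iff by blast+
    then show "feasible B g ?y" "objective p q ?y = \<theta>"
      using lower by (auto intro: order_antisym)
  qed
  have arg_min_iff: "is_arg_min (objective p q) (feasible B g) x \<longleftrightarrow>
      feasible B g x \<and> objective p q x \<le> \<theta>" for x
    using y lower unfolding is_arg_min_def by (metis not_le order_trans)
  have "is_arg_min (objective p q) (feasible B g) x \<longleftrightarrow>
      (\<exists>u. g \<le> u \<and> x = asterate C *v u)" if "regular x" for x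
    using arg_min_iff feasible_iff C_iff[OF that] subsolution_iff_asterate[OF Tr_C] that by blast
  moreover have "\<exists>x. is_arg_min (objective p q) (feasible B g) x \<and> objective p q x = \<theta>"
    using y arg_min_iff by auto
  ultimately show ?thesis unfolding C_def by blast
qed

end
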